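(* Let $M$ be an $\ell e$-$\Gamma$-semigroup, let $m,n\in\mathbb{N}=\{1,2,3,\dots\}$ and let $\beta,\gamma\in\Gamma$. Suppose $M$ is $\beta$-subidempotent, i.e. $a\beta a\le a$ for every $a\in M$. The following are equivalent: (1) $M$ is $(m,n,\beta,\gamma)$-regular, i.e. $a\le a_\beta^m\beta e\gamma a_\gamma^n$ for every $a\in M$. (2) $a\wedge b=a_\beta^m\beta b\wedge a\gamma b_\gamma^n$ for every $(m,0,\beta)$-ideal element $a$ of $M$ and every $(0,n,\gamma)$-ideal element $b$ of $M$.
   Context: A $\Gamma$-semigroup consists of nonempty sets $M$ and $\Gamma$ together with a map $M\times\Gamma\times M\to M$, $(a,\gamma,b)\mapsto a\gamma b$, such that $(a\gamma b)\mu c=a\gamma(b\mu c)$ for all $a,b,c\in M$, $\gamma,\mu\in\Gamma$. An $\ell e$-$\Gamma$-semigroup is a $\Gamma$-semigroup $M$ that is also a lattice (partial order $\le$ with binary supremum $\vee$ and infimum $\wedge$) with a greatest element $e$, such that $a\gamma(b\vee c)=a\gamma b\vee a\gamma c$ and $(a\vee b)\gamma c=a\gamma c\vee b\gamma c$ for all $a,b,c\in M$, $\gamma\in\Gamma$. Powers: for $a\in M$, $\gamma\in\Gamma$, put $a_\gamma^1:=a$ and, for $m\ge 2$, $a_\gamma^m:=a\gamma a\gamma\cdots\gamma a$ ($m$ copies of $a$ and $m-1$ copies of $\gamma$). An element $a\in M$ is an $(m,0,\beta)$-ideal element if $a_\beta^m\beta e\le a$, and an element $b\in M$ is a $(0,n,\gamma)$-ideal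 element if $e\gamma b_\gamma^n\le b$. *)

theory Defs
  imports Main
begin

text \<open>
  The sets \<open>M\<close> and \<open>\<Gamma>\<close> are the types \<open>'a\<close> and \<open>'g\<close>; \<open>mul a \<gamma> b\<close> stands for \<open>a\<gamma>b\<close>.
\<close>

locale gamma_semigroup =
  fixes mul :: "'a \<Rightarrow> 'g \<Rightarrow> 'a \<Rightarrow> 'a"
  assumes mul_assoc: "mul (mul a \<gamma> b) \<mu> c = mul a \<gamma> (mul b \<mu> c)"

text \<open>The greatest element \<open>e\<close> is \<open>top\<close>.\<close>

locale le_gamma_semigroup = gamma_semigroup mul
  for mul :: "'a::bounded_lattice_top \<Rightarrow> 'g \<Rightarrow> 'a \<Rightarrow> 'a" +
  assumes mul_sup_right: "mul a \<gamma> (sup b c) = sup (mul a \<gamma> b) (mul a \<gamma> c)"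
    and mul_sup_left: "mul (sup a b) \<gamma> c = sup (mul a \<gamma> c) (mul b \<gamma> c)"

text \<open>
  \<open>gpow mul a \<gamma> m = a\<gamma>a\<gamma>\<dots>\<gamma>a\<close> with \<open>m\<close> copies of \<open>a\<close>, bracketed to the left.
  Only exponents \<open>m \<ge> 1\<close> are meaningful; \<open>m = 0\<close> yields the junk value \<open>a\<close>.
\<close>

definition gpow :: "('a \<Rightarrow> 'g \<Rightarrow> 'a \<Rightarrow> 'a) \<Rightarrow> 'a \<Rightarrow> 'g \<Rightarrow> nat \<Rightarrow> 'a" where
  "gpow mul a \<gamma> m = ((\<lambda>x. mul x \<gamma> a) ^^ (m - 1)) a"

definition subidempotent :: "('a::ord \<Rightarrow> 'g \<Rightarrow> 'a \<Rightarrow> 'a) \<Rightarrow> 'g \<Rightarrow> bool" where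
  "subidempotent mul \<beta> \<longleftrightarrow> (\<forall>a. mul a \<beta> a \<le> a)"

text \<open>\<open>(m,0,\<beta>)\<close>- and \<open>(0,n,\<gamma>)\<close>-ideal elements.\<close>

definition m_zero_ideal_element ::
    "('a::order_top \<Rightarrow> 'g \<Rightarrow> 'a \<Rightarrow> 'a) \<Rightarrow> nat \<Rightarrow> 'g \<Rightarrow> 'a \<Rightarrow> bool" where
  "m_zero_ideal_element mul m \<beta> a \<longleftrightarrow> mul (gpow mul a \<beta> m) \<beta> top \<le> a"

definition zero_n_ideal_element ::
    "('a::order_top \<Rightarrow> 'g \<Rightarrow> 'a \<Rightarrow> 'a) \<Rightarrow> nat \<Rightarrow> 'g \<Rightarrow> 'a \<Rightarrow> bool" where
  "zero_n_ideal_element mul n \<gamma> b \<longleftrightarrow> mul top \<gamma> (gpow mul b \<gamma> n) \<le> b"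

definition gamma_regular ::
    "('a::order_top \<Rightarrow> 'g \<Rightarrow> 'a \<Rightarrow> 'a) \<Rightarrow> nat \<Rightarrow> nat \<Rightarrow> 'g \<Rightarrow> 'g \<Rightarrow> bool" where
  "gamma_regular mul m n \<beta> \<gamma> \<longleftrightarrow>
    (\<forall>a. a \<le> mul (mul (gpow mul a \<beta> m) \<beta> top) \<gamma> (gpow mul a \<gamma> n))"

end

theory Submission
  imports Defs
begin

text \<open>
  The forward direction is monotonicity. For the converse, put \<open>A = a \<or> a\<^sup>m\<beta>e\<close> and
  \<open>B = a \<or> e\<gamma>a\<^sup>n\<close>. Expanding the products gives \<open>A\<^sup>m\<beta>e \<le> a\<^sup>m\<beta>e\<close> and
  \<open>e\<gamma>B\<^sup>n \<le> e\<gamma>a\<^sup>n\<close>, so \<open>A\<close> and \<open>B\<close> are ideal elements of the two kinds.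
  Condition (2) for the pair \<open>e, B\<close> yields \<open>B \<le> e\<gamma>B\<^sup>n \<le> e\<gamma>a\<^sup>n\<close>, and for the pair \<open>A, B\<close> it
  then yields \<open>a \<le> A\<^sup>m\<beta>B \<le> (A\<^sup>m\<beta>e)\<gamma>a\<^sup>n \<le> (a\<^sup>m\<beta>e)\<gamma>a\<^sup>n\<close>.
\<close>

context gamma_semigroup
begin

lemma mul_funpow: "mul ((mul a \<beta> ^^ k) x) \<mu> y = (mul a \<beta> ^^ k) (mul x \<mu> y)"
  by (induction k) (simp_all add: mul_assoc)

text \<open>Iterates suit induction and monotonicity better than powers. Powers grow on the right,
  so associativity must carry the new factor through the iterate. The exponent is positive because
  \<open>gpow\<close> at 0 is still \<open>a\<close>.\<close>

lemma mul_gpow_left: "m \<ge> 1 \<Longrightarrow> mul (gpow mul a \<beta> m) \<beta> x = (mul a \<beta> ^^ m) x"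
proof (induction m arbitrary: x rule: nat_induct_at_least)
  case base
  then show ?case by (simp add: gpow_def)
next
  case (Suc m)
  then obtain k where "m = Suc k" by (cases m) auto
  then have "gpow mul a \<beta> (Suc m) = mul (gpow mul a \<beta> m) \<beta> a"
    by (simp add: gpow_def)
  then show ?case
    using Suc.IH by (simp add: mul_funpow funpow_swap1)
qed

lemma mul_gpow_right: "n \<ge> 1 \<Longrightarrow> mul x \<gamma> (gpow mul a \<gamma> n) = ((\<lambda>y. mul y \<gamma> a) ^^ n) x"
proof (induction n rule: nat_induct_at_least)
  case base
  then show ?case by (simp add: gpow_def)
next
  case (Suc n)
  then obtain k where "n = Suc k" by (cases n) auto
  then have "gpow mul a \<gamma> (Suc n) = mul (gpow mul a \<gamma> n) \<gamma> a"
    by (simp add: gpow_def)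
  then show ?case
    using Suc.IH by (simp flip: mul_assoc)
qed

end

context le_gamma_semigroup
begin

lemma mul_mono: "a \<le> b \<Longrightarrow> c \<le> d \<Longrightarrow> mul a \<gamma> c \<le> mul b \<gamma> d"
  by (rule order_trans[of _ "mul b \<gamma> c"]) (simp_all add: le_iff_sup flip: mul_sup_left mul_sup_right)

lemma funpow_mul_mono: "a \<le> b \<Longrightarrow> x \<le> y \<Longrightarrow> (mul a \<gamma> ^^ k) x \<le> (mul b \<gamma> ^^ k) y"
  by (induction k) (auto intro: mul_mono)

text \<open>Each new factor splits by distributivity: the part \<open>a\<close> adds one iterate,
  the other part is absorbed while \<open>k \<le> m\<close>. The case \<open>k = m\<close> is the
  one that produces ideal elements.\<close>

lemma funpow_mul_sup_top_le:
  assumes "k \<le> m"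
  shows "(mul (sup a ((mul a \<beta> ^^ m) top)) \<beta> ^^ k) top \<le> (mul a \<beta> ^^ k) top"
  using assms
proof (induction k)
  case 0
  then show ?case by simp
next
  case (Suc k)
  let ?T = "\<lambda>i. (mul a \<beta> ^^ i) top"
  \<comment> \<open>Associativity turns the left side into \<open>m\<close> multiplications by
    \<open>a\<close> applied to an element below \<open>top\<close>.\<close>
  have "mul (?T m) \<beta> (?T k) \<le> ?T m"
    by (simp add: mul_funpow funpow_mul_mono)
  \<comment> \<open>Iterates of a monotone map started at \<open>top\<close> decrease.\<close>
  also have "\<dots> \<le> ?T (Suc k)"
    using Suc.prems by (rule funpow_increasing) (simp add: mono_def mul_mono)
  finally have "mul (sup a (?T m)) \<beta> (?T k) \<le> ?T (Suc k)"
    by (simp add: mul_sup_left)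
  moreover have "mul (sup a (?T m)) \<beta> ((mul (sup a (?T m)) \<beta> ^^ k) top)
      \<le> mul (sup a (?T m)) \<beta> (?T k)"
    using Suc by (intro mul_mono) auto
  ultimately show ?case by (auto intro: order_trans)
qed

text \<open>Reversing products transfers the facts on iterated left multiplication to the
  right.\<close>

lemma le_gamma_semigroup_opposite: "le_gamma_semigroup (\<lambda>a \<gamma> b. mul b \<gamma> a)"
  by unfold_locales (simp_all add: mul_assoc mul_sup_left mul_sup_right)

end

theorem theorem12:
  fixes mul :: "'a::bounded_lattice_top \<Rightarrow> 'g \<Rightarrow> 'a \<Rightarrow> 'a"
    and m n :: nat
    and \<beta> \<gamma> :: 'g
  assumes "le_gamma_semigroup mul"
    and "m \<ge> 1" and "n \<ge> 1"
    and "subidempotent mul \<beta>"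
  shows "gamma_regular mul m n \<beta> \<gamma> \<longleftrightarrow>
    (\<forall>a b. m_zero_ideal_element mul m \<beta> a \<longrightarrow> zero_n_ideal_element mul n \<gamma> b \<longrightarrow>
      inf a b = inf (mul (gpow mul a \<beta> m) \<beta> b) (mul a \<gamma> (gpow mul b \<gamma> n)))"
proof -
  interpret le_gamma_semigroup mul by fact
  interpret opp: le_gamma_semigroup "\<lambda>a \<gamma> b. mul b \<gamma> a"
    by (rule le_gamma_semigroup_opposite)
  define L where "L a = mul a \<beta> ^^ m" for a
  define R where "R b = (\<lambda>x. mul x \<gamma> b) ^^ n" for b
  have L: "mul (gpow mul a \<beta> m) \<beta> x = L a x" for a x
    using \<open>m \<ge> 1\<close> by (simp add: L_def mul_gpow_left)
  have R: "mul x \<gamma> (gpow mul b \<gamma> n) = R b x" for b x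
    using \<open>n \<ge> 1\<close> by (simp add: R_def mul_gpow_right)
  have L_mono: "L a x \<le> L b y" if "a \<le> b" "x \<le> y" for a b x y
    using that unfolding L_def by (rule funpow_mul_mono)
  have R_mono: "R a x \<le> R b y" if "a \<le> b" "x \<le> y" for a b x y
    using that unfolding R_def by (rule opp.funpow_mul_mono)
  \<comment> \<open>Associativity lets either side act first, so either ideal condition can be
    applied to \<open>top\<close>.\<close>
  have RL: "R b (L a x) = L a (R b x)" for a b x
    by (simp flip: L R add: mul_assoc)
  show ?thesis
    unfolding gamma_regular_def m_zero_ideal_element_def zero_n_ideal_element_def L R
  proof (intro iffI allI impI)
    fix a b
    assume reg: "\<forall>a. a \<le> R a (L a top)" and a: "L a top \<le> a" and b: "R b top \<le> b"
    \<comment> \<open>Regularity is used at the meet, which can be enlarged to \<open>a\<close> or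
      to \<open>b\<close> in each factor.\<close>
    have c: "inf a b \<le> R (inf a b) (L (inf a b) top)"
      using reg by blast
    show "inf a b = inf (L a b) (R b a)"
    proof (rule antisym; rule le_infI)
      have "R (inf a b) (L (inf a b) top) = L (inf a b) (R (inf a b) top)"
        by (rule RL)
      also have "\<dots> \<le> L a b"
        by (intro L_mono order_trans[OF R_mono b]) simp_all
      finally show "inf a b \<le> L a b"
        using c by (rule order_trans[rotated])
      have "R (inf a b) (L (inf a b) top) \<le> R b a"
        by (intro R_mono order_trans[OF L_mono a]) simp_all
      then show "inf a b \<le> R b a"
        using c by (rule order_trans[rotated])
      show "inf (L a b) (R b a) \<le> a"
        by (intro le_infI1 order_trans[OF L_mono a]) simp_all
      show "inf (L a b) (R b a) \<le> b"
        by (intro le_infI2 order_trans[OF R_mono b]) simp_all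
    qed
  next
    fix a
    assume eq: "\<forall>a b. L a top \<le> a \<longrightarrow> R b top \<le> b \<longrightarrow> inf a b = inf (L a b) (R b a)"
    define A where "A = sup a (L a top)"
    define B where "B = sup a (R a top)"
    have A: "L A top \<le> L a top"
      unfolding A_def L_def by (rule funpow_mul_sup_top_le) simp
    have B: "R B top \<le> R a top"
      unfolding B_def R_def by (rule opp.funpow_mul_sup_top_le) simp
    have A_ideal: "L A top \<le> A" and B_ideal: "R B top \<le> B"
      using A B by (simp_all add: A_def B_def le_supI2)
    \<comment> \<open>\<open>top\<close> is trivially an ideal element and neutral for
      \<open>inf\<close>.\<close>
    have "B = inf (L top B) (R B top)"
      using eq[rule_format, of top B] B_ideal by simp
    then have "B \<le> R B top"
      by (metis inf_le2)
    also note B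
    finally have B_le: "B \<le> R a top" .
    have "a \<le> inf A B"
      by (simp add: A_def B_def)
    also have "\<dots> \<le> L A B"
      using eq[rule_format, OF A_ideal B_ideal] by simp
    also have "\<dots> \<le> L A (R a top)"
      using B_le by (intro L_mono order_refl)
    also have "\<dots> = R a (L A top)"
      by (simp add: RL)
    also have "\<dots> \<le> R a (L a top)"
      using A by (intro R_mono order_refl)
    finally show "a \<le> R a (L a top)" .
  qed
qed

end
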